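(* Let $f_p,g_p,V,\sigma,c,\Theta$ satisfy the standing assumptions in the context. Assume that the learned controller has the form $$\hat u(x,\theta)=\sum_{k=1}^K\theta_k u_k(x),$$ where $u_1,\dots,u_K:\mathbb{R}^n\to\mathbb{R}^m$ are locally Lipschitz continuous and $\theta_k$ is the $k$-th entry of $\theta$, and that the set $\{u_k\}_{k=1}^K$ (restricted to $W^c$) is linearly independent in the vector space $C(W^c,\mathbb{R}^m)$ of continuous functions from $W^c$ to $\mathbb{R}^m$. Then for each $\lambda\in\mathbb{R}_{\ge0}$ the loss $L_\lambda$ is a strongly convex function of $\theta$.
   Context: Setting. Consider the control-affine system (plant) $\dot x=f_p(x)+g_p(x)u$ with state $x\in\mathbb{R}^n$ and input $u\in\mathbb{R}^m$, where $f_p:\mathbb{R}^n\to\mathbb{R}^n$, $g_p:\mathbb{R}^n\to\mathbb{R}^{n\times m}$ and $f_p(0)=0$. Let $V:\mathbb{R}^n\to\mathbb{R}_{\ge 0}$ be continuously differentiable, positive definite ($V(0)=0$ and $V(x)>0$ for $x\ne0$) and radially unbounded ($V(x)\to\infty$ as $\|x\|\to\infty$), with gradient $\nabla V(x)\in\mathbb{R}^{1\times n}$ regarded as a row vector, and let $\sigma:\mathbb{R}^n\to\mathbb{R}_{\ge0}$ be positive definite. Fix $c>0$ and let $W^c=\{x\in\mathbb{R}^n: V(x)\le c\}$. Standing assumptions. (i) $f_p$, $g_p$, $\sigma$ and $\nabla V$ are locally Lipschitz continuous. (ii) There exists a locally Lipschitz continuous $\tilde u_p:\mathbb{R}^n\to\mathbb{R}^m$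 such that $\nabla V(x)[f_p(x)+g_p(x)\tilde u_p(x)]\le-\sigma(x)$ for each $x\in W^c$. (iii) $\Theta\subset\mathbb{R}^K$, the set of allowable parameters $\theta$, is convex. Loss. For a learned controller $\hat u:\mathbb{R}^n\times\Theta\to\mathbb{R}^m$ define $\Delta(x,\theta)=\nabla V(x)[f_p(x)+g_p(x)\hat u(x,\theta)]+\sigma(x)$ and $H(y)=\max\{0,y\}$ for $y\in\mathbb{R}$. For $\lambda\in\mathbb{R}_{\ge0}$ the loss $L_\lambda:\Theta\to\mathbb{R}$ is $$L_\lambda(\theta)=E_{x\sim X}\big[\|\hat u(x,\theta)\|_2^2+\lambda H(\Delta(x,\theta))\big],$$ where $X$ is the uniform probability distribution on $W^c$. *)

theory Defs
  imports "HOL-Analysis.Analysis"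
begin

text \<open>The library notion of local Lipschitz continuity carries an extra (time) parameter;
  here it is a dummy.\<close>

definition locally_lipschitz :: "('a::metric_space \<Rightarrow> 'b::metric_space) \<Rightarrow> bool" where
  "locally_lipschitz f \<longleftrightarrow> local_lipschitz (UNIV :: real set) UNIV (\<lambda>_. f)"

definition positive_definite :: "('a::real_normed_vector \<Rightarrow> real) \<Rightarrow> bool" where
  "positive_definite V \<longleftrightarrow> V 0 = 0 \<and> (\<forall>x. x \<noteq> 0 \<longrightarrow> V x > 0)"

definition sublevel :: "('a \<Rightarrow> real) \<Rightarrow> real \<Rightarrow> 'a set" where
  "sublevel V c = {x. V x \<le> c}"

text \<open>Linear independence, in the space of functions on \<open>S\<close>, of the finite family \<open>u\<close>.
  Repetitions in the family count as dependence. The functions need not vanish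
  off \<open>S\<close>: only their restrictions to \<open>S\<close> matter.\<close>

definition lin_indep_on :: "'a set \<Rightarrow> ('k::finite \<Rightarrow> 'a \<Rightarrow> 'b::real_vector) \<Rightarrow> bool" where
  "lin_indep_on S u \<longleftrightarrow>
    (\<forall>a. (\<forall>x\<in>S. (\<Sum>k\<in>UNIV. a k *\<^sub>R u k x) = 0) \<longrightarrow> (\<forall>k. a k = 0))"

definition strongly_convex_on :: "'a::real_inner set \<Rightarrow> ('a \<Rightarrow> real) \<Rightarrow> bool" where
  "strongly_convex_on S f \<longleftrightarrow> convex S \<and>
    (\<exists>\<mu>>0. \<forall>x\<in>S. \<forall>y\<in>S. \<forall>t\<in>{0..1}.
      f (t *\<^sub>R x + (1 - t) *\<^sub>R y) \<le>
        t * f x + (1 - t) * f y - \<mu> / 2 * t * (1 - t) * (norm (x - y))\<^sup>2)"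

definition hinge :: "real \<Rightarrow> real" where
  "hinge y = max 0 y"

text \<open>In the following, \<open>DV x\<close> is the gradient of \<open>V\<close> at \<open>x\<close>; the product of the row vector
  \<open>DV x\<close> with a column vector is the inner product. The matrix \<open>g x\<close> has
  rows indexed by \<open>'n\<close> and columns indexed by \<open>'m\<close>.\<close>

definition Delta ::
  "(real^'n \<Rightarrow> real^'n) \<Rightarrow> (real^'n \<Rightarrow> real^'n) \<Rightarrow> (real^'n \<Rightarrow> real^'m^'n) \<Rightarrow> (real^'n \<Rightarrow> real) \<Rightarrow>
   (real^'n \<Rightarrow> real^'k \<Rightarrow> real^'m) \<Rightarrow> real^'n \<Rightarrow> real^'k \<Rightarrow> real" where
  "Delta DV f g \<sigma> uh x \<theta> = DV x \<bullet> (f x + g x *v uh x \<theta>) + \<sigma> x"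

definition loss ::
  "(real^'n \<Rightarrow> real) \<Rightarrow> real \<Rightarrow>
   (real^'n \<Rightarrow> real^'n) \<Rightarrow> (real^'n \<Rightarrow> real^'n) \<Rightarrow> (real^'n \<Rightarrow> real^'m^'n) \<Rightarrow> (real^'n \<Rightarrow> real) \<Rightarrow>
   (real^'n \<Rightarrow> real^'k \<Rightarrow> real^'m) \<Rightarrow> real \<Rightarrow> real^'k \<Rightarrow> real" where
  "loss V c DV f g \<sigma> uh l \<theta> =
    (\<integral>x. (norm (uh x \<theta>))\<^sup>2 + l * hinge (Delta DV f g \<sigma> uh x \<theta>)
      \<partial>(uniform_measure lborel (sublevel V c)))"

end

theory Submission
  imports Defs
begin

text \<open>By homogeneity and compactness of the unit sphere, strong convexity of the quadratic part
  reduces to positivity of \<open>E \<parallel>\<Sum> a\<^sub>k u\<^sub>k\<parallel>\<^sup>2\<close> for \<open>a \<noteq> 0\<close>; the hinge term is convex. If this expectation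
  vanishes, then the continuous function \<open>\<Sum> a\<^sub>k u\<^sub>k\<close> vanishes on the open set \<open>V < c\<close>.
  The stabilizability assumption forces the gradient of \<open>V\<close> to be nonzero wherever \<open>V = c\<close>, so
  the closure of this open set is the whole sublevel set, and linear independence gives
  \<open>a = 0\<close>.\<close>

section \<open>Continuity, quadratic forms and convexity inequalities\<close>

lemma locally_lipschitz_continuous:
  assumes "locally_lipschitz f"
  shows "continuous_on UNIV f"
proof (rule continuous_on_eq_continuous_within[THEN iffD2], rule ballI)
  fix x
  have "local_lipschitz (UNIV :: real set) UNIV (\<lambda>_. f)"
    using assms by (simp add: locally_lipschitz_def)
  then obtain e L where e: "e > 0"
    and L: "\<And>t. t \<in> cball (0::real) e \<inter> UNIV \<Longrightarrow> L-lipschitz_on (cball x e \<inter> UNIV) f"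
    by (rule local_lipschitzE[where x=x and t=0]) auto
  have "L-lipschitz_on (cball x e) f"
    using L[of 0] e by simp
  then have "continuous_on (cball x e) f"
    by (rule lipschitz_on_continuous_on)
  then have "continuous_on (ball x e) f"
    by (rule continuous_on_subset) auto
  then show "continuous (at x within UNIV) f"
    using e by (simp add: continuous_on_eq_continuous_at)
qed

text \<open>The minimum of \<open>q\<close> over the compact unit sphere serves as \<open>m\<close>;
  degree-two homogeneity carries the bound to every vector. This turns mere positivity into a
  uniform modulus.\<close>

lemma homogeneous_quadratic_lower_bound:
  fixes q :: "'a::euclidean_space \<Rightarrow> real"
  assumes cont: "continuous_on UNIV q"
    and hom: "\<And>s x. q (s *\<^sub>R x) = s\<^sup>2 * q x"
    and pos: "\<And>x. x \<noteq> 0 \<Longrightarrow> q x > 0"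
  shows "\<exists>m>0. \<forall>x. m * (norm x)\<^sup>2 \<le> q x"
proof -
  have "\<exists>z\<in>sphere 0 1. \<forall>y\<in>sphere 0 1. q z \<le> q y"
    by (rule continuous_attains_inf) (auto intro: continuous_on_subset[OF cont])
  then obtain z where z: "norm z = 1" "\<And>y. norm y = 1 \<Longrightarrow> q z \<le> q y"
    by auto
  have "q z * (norm x)\<^sup>2 \<le> q x" for x
  proof (cases "x = 0")
    case True
    then show ?thesis using hom[of 0 0] by simp
  next
    case False
    then have "q z \<le> q ((1 / norm x) *\<^sub>R x)"
      by (intro z(2)) simp
    also have "\<dots> = q x / (norm x)\<^sup>2"
      by (simp only: hom) (simp add: power_divide)
    finally show ?thesis
      using False by (simp add: field_simps)
  qed
  moreover have "q z > 0"
    using z(1) by (intro pos) auto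
  ultimately show ?thesis by blast
qed

text \<open>Stated as an identity because the subtracted defect term is what becomes the strong
  convexity modulus after integration.\<close>

lemma norm_convex_combination_sq:
  fixes a b :: "'a::real_inner"
  shows "(norm (t *\<^sub>R a + (1 - t) *\<^sub>R b))\<^sup>2 =
    t * (norm a)\<^sup>2 + (1 - t) * (norm b)\<^sup>2 - t * (1 - t) * (norm (a - b))\<^sup>2"
  unfolding power2_norm_eq_inner
  by (simp add: inner_add_left inner_add_right inner_diff_left inner_diff_right
      inner_commute[of b a] algebra_simps power2_eq_square)

lemma hinge_convex_combination:
  assumes "0 \<le> t" "t \<le> 1"
  shows "hinge (t * a + (1 - t) * b) \<le> t * hinge a + (1 - t) * hinge b"
proof -
  \<comment> \<open>The right-hand side must dominate both arguments of the maximum: the first two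
    facts handle the convex combination, the last two handle 0.\<close>
  have "t * a \<le> t * hinge a" "(1 - t) * b \<le> (1 - t) * hinge b"
    "0 \<le> t * hinge a" "0 \<le> (1 - t) * hinge b"
    using assms by (auto simp: hinge_def intro!: mult_left_mono mult_nonneg_nonneg)
  then show ?thesis by (simp add: hinge_def[of "t * a + (1 - t) * b"])
qed

section \<open>Compact sublevel sets and their uniform measure\<close>

lemma compact_sublevel:
  fixes V :: "'a::euclidean_space \<Rightarrow> real"
  assumes cont: "continuous_on UNIV V" and lim: "filterlim V at_top at_infinity"
  shows "compact (sublevel V c)"
proof -
  have "eventually (\<lambda>x. V x > c) at_infinity"
    using lim by (simp add: filterlim_at_top_dense)
  then obtain b where b: "\<And>x. norm x \<ge> b \<Longrightarrow> V x > c"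
    by (auto simp: eventually_at_infinity)
  have "norm x \<le> b" if "x \<in> sublevel V c" for x
    using that b[of x] by (fastforce simp: sublevel_def)
  then have "bounded (sublevel V c)"
    by (auto simp: bounded_iff)
  moreover have "closed (sublevel V c)"
    unfolding sublevel_def using cont by (intro closed_Collect_le) auto
  ultimately show ?thesis by (simp add: compact_eq_bounded_closed)
qed

text \<open>The uniform measure is finite and concentrated on \<open>W\<close>, where a continuous
  function is bounded; continuity on the whole space gives measurability.\<close>

lemma integrable_uniform_measure_compact:
  fixes h :: "'a::euclidean_space \<Rightarrow> real"
  assumes "compact W" "emeasure lborel W \<noteq> 0" and cont: "continuous_on UNIV h"
  shows "integrable (uniform_measure lborel W) h"
proof -
  have W: "W \<in> sets borel" "emeasure lborel W < \<infinity>"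
    using assms emeasure_compact_finite[of W] by (auto intro: borel_compact)
  then interpret finite_measure "uniform_measure lborel W"
    using assms by (intro finite_measureI) (simp add: ennreal_divide_self)
  have "bounded (h ` W)"
    using assms by (intro compact_imp_bounded compact_continuous_image
        continuous_on_subset[OF cont]) auto
  then obtain B where B: "\<And>x. x \<in> W \<Longrightarrow> norm (h x) \<le> B"
    by (auto simp: bounded_iff)
  show ?thesis
  proof (rule integrable_const_bound)
    show "AE x in uniform_measure lborel W. norm (h x) \<le> B"
      using W B by (intro AE_uniform_measureI) auto
    show "h \<in> borel_measurable (uniform_measure lborel W)"
      using borel_measurable_continuous_onI[OF cont] by simp
  qed
qed

text \<open>The points of \<open>U\<close> where \<open>h\<close> is nonzero form an open null set,
  and a nonempty open set is never Lebesgue null.\<close>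

lemma open_AE_lborel_eq_zero:
  fixes h :: "'a::euclidean_space \<Rightarrow> real"
  assumes cont: "continuous_on UNIV h" and U: "open U"
    and ae: "AE x in lborel. x \<in> U \<longrightarrow> h x = 0" and x: "x \<in> U"
  shows "h x = 0"
proof (rule ccontr)
  assume hx: "h x \<noteq> 0"
  define S where "S = U \<inter> {x. h x \<noteq> 0}"
  have S: "open S"
    unfolding S_def using cont U by (intro open_Int open_Collect_neq) auto
  have "AE x in lborel. x \<notin> S"
    using ae by eventually_elim (auto simp: S_def)
  then have "S \<in> null_sets lborel"
    using S AE_iff_null_sets[of S lborel] by auto
  then have "negligible S"
    by (simp add: negligible_iff_null_sets null_sets_completionI)
  then show False
    using open_not_negligible[OF S] x hx by (auto simp: S_def)
qed

text \<open>From a point with \<open>V x = c\<close>, a short move against the nonzero gradient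
  strictly lowers \<open>V\<close>, so the point is a limit of points with smaller value.\<close>

lemma sublevel_subset_closure:
  fixes V :: "'a::real_inner \<Rightarrow> real"
  assumes grad: "\<And>x. GDERIV V x :> DV x"
    and nz: "\<And>x. V x = c \<Longrightarrow> DV x \<noteq> 0"
  shows "sublevel V c \<subseteq> closure {x. V x < c}"
proof
  fix x assume x: "x \<in> sublevel V c"
  show "x \<in> closure {x. V x < c}"
  proof (cases "V x = c")
    case False
    then show ?thesis
      using x by (intro subsetD[OF closure_subset]) (auto simp: sublevel_def)
  next
    case True
    define \<gamma> where "\<gamma> s = x - s *\<^sub>R DV x" for s :: real
    have "(V has_derivative (\<lambda>h. h \<bullet> DV x)) (at (\<gamma> 0))"
      using grad[of x] by (simp add: gderiv_def \<gamma>_def inner_commute)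
    moreover have "(\<gamma> has_derivative (\<lambda>h. - (h *\<^sub>R DV x))) (at 0)"
      unfolding \<gamma>_def by (auto intro!: derivative_eq_intros)
    ultimately have "(V \<circ> \<gamma> has_derivative (\<lambda>h. h \<bullet> DV x) \<circ> (\<lambda>h. - (h *\<^sub>R DV x))) (at 0)"
      by (intro diff_chain_at)
    \<comment> \<open>Along the ray \<open>\<gamma>\<close> the slope of \<open>V\<close> at 0 is
      minus the squared norm of the gradient.\<close>
    then have "DERIV (V \<circ> \<gamma>) 0 :> - (DV x \<bullet> DV x)"
      unfolding has_field_derivative_def by (rule has_derivative_eq_rhs) (simp_all add: o_def fun_eq_iff)
    moreover have "- (DV x \<bullet> DV x) < 0"
      using nz[OF True] by simp
    ultimately obtain d where d: "d > 0" "\<And>h. h > 0 \<Longrightarrow> h < d \<Longrightarrow> (V \<circ> \<gamma>) h < (V \<circ> \<gamma>) 0"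
      using DERIV_neg_dec_right[of "V \<circ> \<gamma>"] by (metis add_0)
    have "eventually (\<lambda>h. h \<in> {0<..<d}) (at_right (0::real))"
      by (rule eventually_at_right_real[OF d(1)])
    then have "eventually (\<lambda>h. \<gamma> h \<in> closure {x. V x < c}) (at_right 0)"
    proof eventually_elim
      case (elim h)
      then have "\<gamma> h \<in> {x. V x < c}"
        using d(2)[of h] True by (simp add: \<gamma>_def)
      then show ?case by (rule subsetD[OF closure_subset])
    qed
    moreover have "(\<gamma> \<longlongrightarrow> x) (at_right 0)"
      unfolding \<gamma>_def by (auto intro!: tendsto_eq_intros)
    ultimately show ?thesis
      by (intro Lim_in_closed_set[of "closure {x. V x < c}" \<gamma> "at_right 0"]) auto
  qed
qed

lemma continuous_on_matrix_vector_mult: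
  fixes A :: "'a::topological_space \<Rightarrow> real^'m^'n"
  assumes "continuous_on S A" "continuous_on S h"
  shows "continuous_on S (\<lambda>x. A x *v h x)"
  unfolding matrix_vector_mult_def using assms by (intro continuous_intros)

text \<open>The integral is the quadratic form of the Gram matrix of the \<open>u k\<close> under
  the uniform measure. The dense open set \<open>U\<close> bridges the gap between vanishing almost
  everywhere and vanishing on all of \<open>W\<close>, where linear independence applies.\<close>

lemma expected_sq_lower_bound:
  fixes u :: "'k::finite \<Rightarrow> 'a::euclidean_space \<Rightarrow> 'b::real_inner"
  assumes W: "compact W" "emeasure lborel W \<noteq> 0"
    and U: "open U" "U \<subseteq> W" "W \<subseteq> closure U"
    and u: "\<And>k. continuous_on UNIV (u k)"
    and indep: "lin_indep_on W u"
  shows "\<exists>m>0. \<forall>a::real^'k. m * (norm a)\<^sup>2 \<le>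
      (\<integral>x. (norm (\<Sum>k\<in>UNIV. (a $ k) *\<^sub>R u k x))\<^sup>2 \<partial>uniform_measure lborel W)"
proof -
  let ?M = "uniform_measure lborel W"
  define q where "q a = (\<integral>x. (norm (\<Sum>k\<in>UNIV. (a $ k) *\<^sub>R u k x))\<^sup>2 \<partial>?M)" for a :: "real^'k"
  have W_sets: "W \<in> sets borel" "emeasure lborel W < \<infinity>"
    using W emeasure_compact_finite[of W] by (auto intro: borel_compact)
  have int: "integrable ?M (\<lambda>x. u i x \<bullet> u j x)" for i j
    by (rule integrable_uniform_measure_compact[OF W]) (intro continuous_intros u)
  \<comment> \<open>Expanding the square makes \<open>q\<close> a polynomial in the entries of
    \<open>a\<close>, so its continuity needs no limit under the integral.\<close>
  have q_gram: "q a = (\<Sum>i\<in>UNIV. \<Sum>j\<in>UNIV. a $ i * (a $ j * (\<integral>x. u j x \<bullet> u i x \<partial>?M)))" for a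
    unfolding q_def power2_norm_eq_inner inner_sum_left inner_sum_right
    by (simp add: int)
  have cont: "continuous_on UNIV q"
    unfolding q_gram[abs_def] by (intro continuous_intros)
  have hom: "q (s *\<^sub>R a) = s\<^sup>2 * q a" for s a
  proof -
    have "(norm (\<Sum>k\<in>UNIV. ((s *\<^sub>R a) $ k) *\<^sub>R u k x))\<^sup>2 =
        s\<^sup>2 * (norm (\<Sum>k\<in>UNIV. (a $ k) *\<^sub>R u k x))\<^sup>2" for x
    proof -
      have "(\<Sum>k\<in>UNIV. ((s *\<^sub>R a) $ k) *\<^sub>R u k x) = s *\<^sub>R (\<Sum>k\<in>UNIV. (a $ k) *\<^sub>R u k x)"
        by (simp add: scaleR_sum_right)
      then show ?thesis by (simp add: power_mult_distrib)
    qed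
    then show ?thesis by (simp add: q_def)
  qed
  have pos: "q a > 0" if "a \<noteq> 0" for a
  proof (rule ccontr)
    assume "\<not> q a > 0"
    moreover have "q a \<ge> 0" unfolding q_def by simp
    ultimately have q0: "q a = 0" by simp
    define h where "h x = (norm (\<Sum>k\<in>UNIV. (a $ k) *\<^sub>R u k x))\<^sup>2" for x
    have h: "continuous_on UNIV h"
      unfolding h_def by (intro continuous_intros u)
    have "AE x in ?M. h x = 0"
    proof (rule integral_nonneg_eq_0_iff_AE[THEN iffD1])
      show "integrable ?M h" by (rule integrable_uniform_measure_compact[OF W h])
      show "AE x in ?M. 0 \<le> h x" by (simp add: h_def)
      show "(\<integral>x. h x \<partial>?M) = 0" using q0 by (simp only: q_def h_def)
    qed
    then have "AE x in lborel. x \<in> W \<longrightarrow> h x = 0"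
      using W W_sets by (subst (asm) AE_uniform_measure) auto
    then have "AE x in lborel. x \<in> U \<longrightarrow> h x = 0"
      by eventually_elim (use U in auto)
    then have hU: "h x = 0" if "x \<in> U" for x
      using open_AE_lborel_eq_zero[OF h U(1) _ that] by simp
    \<comment> \<open>A continuous function that is constant on \<open>U\<close> keeps that value on
      the closure of \<open>U\<close>.\<close>
    have "h x = 0" if "x \<in> W" for x
      using that U(3) continuous_constant_on_closure[of U h 0 x] h hU
      by (auto intro: continuous_on_subset)
    then have "\<forall>x\<in>W. (\<Sum>k\<in>UNIV. (a $ k) *\<^sub>R u k x) = 0"
      by (simp add: h_def)
    then have "\<forall>k. a $ k = 0"
      using indep unfolding lin_indep_on_def by blast
    then show False using that by (simp add: vec_eq_iff)
  qed
  show ?thesis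
    using homogeneous_quadratic_lower_bound[OF cont hom pos] unfolding q_def .
qed

section \<open>Strong convexity of the penalised loss\<close>

theorem lemma2:
  fixes f :: "real^'n \<Rightarrow> real^'n"
    and g :: "real^'n \<Rightarrow> real^'m^'n"
    and V \<sigma> :: "real^'n \<Rightarrow> real"
    and DV :: "real^'n \<Rightarrow> real^'n"
    and c :: real
    and \<Theta> :: "(real^'k) set"
    and u :: "'k \<Rightarrow> real^'n \<Rightarrow> real^'m"
    and uh :: "real^'n \<Rightarrow> real^'k \<Rightarrow> real^'m"
  assumes f0: "f 0 = 0"
    and V_grad: "\<And>x. GDERIV V x :> DV x"
    and V_C1: "continuous_on UNIV DV"
    and V_pd: "positive_definite V"
    and V_unbounded: "filterlim V at_top at_infinity"
    and \<sigma>_pd: "positive_definite \<sigma>"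
    and c_pos: "c > 0"
    and f_lip: "locally_lipschitz f"
    and g_lip: "locally_lipschitz g"
    and \<sigma>_lip: "locally_lipschitz \<sigma>"
    and DV_lip: "locally_lipschitz DV"
    and clf: "\<exists>up :: real^'n \<Rightarrow> real^'m. locally_lipschitz up \<and>
      (\<forall>x\<in>sublevel V c. DV x \<bullet> (f x + g x *v up x) \<le> - \<sigma> x)"
    and \<Theta>_convex: "convex \<Theta>"
    and u_lip: "\<And>k. locally_lipschitz (u k)"
    and uh_eq: "\<And>x \<theta>. \<theta> \<in> \<Theta> \<Longrightarrow> uh x \<theta> = (\<Sum>k\<in>UNIV. (\<theta> $ k) *\<^sub>R u k x)"
    and u_indep: "lin_indep_on (sublevel V c) u"
  shows "\<forall>l\<ge>0. strongly_convex_on \<Theta> (loss V c DV f g \<sigma> uh l)"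
proof (intro allI impI)
  fix l :: real assume l: "l \<ge> 0"
  define W where "W = sublevel V c"
  define U where "U = {x. V x < c}"
  let ?M = "uniform_measure lborel W"
  \<comment> \<open>The formula for \<open>uh\<close> is available only on \<open>\<Theta>\<close>.
    Its linear extension \<open>w\<close> accepts every parameter, in particular differences
    \<open>a - b\<close>, which may leave \<open>\<Theta>\<close>.\<close>
  define w where "w \<theta> x = (\<Sum>k\<in>UNIV. (\<theta> $ k) *\<^sub>R u k x)" for \<theta> :: "real^'k" and x
  define D where "D \<theta> x = DV x \<bullet> (f x + g x *v w \<theta> x) + \<sigma> x" for \<theta> x
  define P where "P \<theta> x = (norm (w \<theta> x))\<^sup>2 + l * hinge (D \<theta> x)" for \<theta> x
  note lip = f_lip g_lip \<sigma>_lip DV_lip u_lip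
  note cont = lip[THEN locally_lipschitz_continuous]
  have V_cont: "continuous_on UNIV V"
    using V_grad by (auto simp: continuous_on_eq_continuous_at gderiv_def
        intro!: has_derivative_continuous)
  have V0: "V 0 = 0" using V_pd by (simp add: positive_definite_def)
  have U: "open U" "U \<subseteq> W" "0 \<in> U"
    unfolding U_def W_def sublevel_def using V_cont V0 c_pos
    by (auto intro!: open_Collect_less)
  have "W \<subseteq> closure U"
    unfolding W_def U_def
  proof (rule sublevel_subset_closure[OF V_grad])
    fix x assume x: "V x = c"
    \<comment> \<open>Away from the origin \<open>\<sigma>\<close> is positive, so the decrease
      inequality makes some directional derivative negative and rules out a zero gradient.\<close>
    then have "x \<noteq> 0" using V0 c_pos by auto
    then have "\<sigma> x > 0" using \<sigma>_pd by (simp add: positive_definite_def)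
    moreover obtain v where "DV x \<bullet> v \<le> - \<sigma> x"
      using clf x by (auto simp: sublevel_def)
    ultimately show "DV x \<noteq> 0" by auto
  qed
  have W: "compact W"
    unfolding W_def by (rule compact_sublevel[OF V_cont V_unbounded])
  \<comment> \<open>\<open>W\<close> contains the open neighbourhood \<open>U\<close> of the origin,
    hence has positive measure.\<close>
  have W_pos: "emeasure lborel W \<noteq> 0"
  proof
    assume "emeasure lborel W = 0"
    then have "W \<in> null_sets lborel"
      using W by (intro null_setsI) (auto intro: borel_compact)
    then have "negligible W"
      by (simp add: negligible_iff_null_sets null_sets_completionI)
    then have "negligible U" using U(2) by (rule negligible_subset)
    then show False using open_not_negligible[OF U(1)] U(3) by auto
  qed
  have "\<exists>m>0. \<forall>a::real^'k. m * (norm a)\<^sup>2 \<le> (\<integral>x. (norm (w a x))\<^sup>2 \<partial>?M)"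
    unfolding w_def
    by (rule expected_sq_lower_bound[OF W W_pos U(1,2) \<open>W \<subseteq> closure U\<close> cont(5)
        u_indep[folded W_def]])
  then obtain m where m: "m > 0"
    "\<And>a::real^'k. m * (norm a)\<^sup>2 \<le> (\<integral>x. (norm (w a x))\<^sup>2 \<partial>?M)"
    by auto
  have w_cont: "continuous_on UNIV (w \<theta>)" for \<theta>
    unfolding w_def[abs_def] by (intro continuous_intros cont)
  have D_cont: "continuous_on UNIV (D \<theta>)" for \<theta>
    unfolding D_def[abs_def]
    by (intro continuous_intros continuous_on_matrix_vector_mult cont w_cont)
  have int_w: "integrable ?M (\<lambda>x. (norm (w \<theta> x))\<^sup>2)" for \<theta>
    by (intro integrable_uniform_measure_compact[OF W W_pos] continuous_intros w_cont)
  have int_P: "integrable ?M (P \<theta>)" for \<theta>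
    unfolding P_def[abs_def] hinge_def
    by (intro integrable_uniform_measure_compact[OF W W_pos] continuous_intros w_cont D_cont)
  have loss_eq: "loss V c DV f g \<sigma> uh l \<theta> = (\<integral>x. P \<theta> x \<partial>?M)" if "\<theta> \<in> \<Theta>" for \<theta>
    unfolding loss_def P_def D_def Delta_def w_def W_def by (simp add: uh_eq[OF that])
  have w_comb: "w (t *\<^sub>R a + (1 - t) *\<^sub>R b) x = t *\<^sub>R w a x + (1 - t) *\<^sub>R w b x" for t a b x
    by (simp add: w_def scaleR_sum_right sum.distrib scaleR_add_left)
  have w_diff: "w (a - b) x = w a x - w b x" for a b x
    by (simp add: w_def sum_subtractf scaleR_diff_left)
  \<comment> \<open>\<open>D\<close> is affine in the parameter: the weights sum to 1, so the terms
    in \<open>f\<close> and \<open>\<sigma>\<close> are reproduced.\<close>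
  have D_comb: "D (t *\<^sub>R a + (1 - t) *\<^sub>R b) x = t * D a x + (1 - t) * D b x" for t a b x
    unfolding D_def w_comb matrix_vector_right_distrib
    by (simp add: inner_add_right matrix_vector_mult_scaleR algebra_simps)
  \<comment> \<open>The squared norm supplies the whole defect; the hinge of an affine function,
    scaled by \<open>l \<ge> 0\<close>, only has to be convex.\<close>
  have P_comb: "P (t *\<^sub>R a + (1 - t) *\<^sub>R b) x \<le>
      t * P a x + (1 - t) * P b x - t * (1 - t) * (norm (w (a - b) x))\<^sup>2"
    if "0 \<le> t" "t \<le> 1" for t a b x
    using mult_left_mono[OF hinge_convex_combination[OF that, of "D a x" "D b x"] l]
    unfolding P_def D_comb w_diff w_comb norm_convex_combination_sq
    by (simp add: algebra_simps)
  \<comment> \<open>The definition of strong convexity carries the factor \<open>\<mu> / 2\<close>,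
    so the bound \<open>m\<close> on the expected square yields modulus
    \<open>2 * m\<close>.\<close>
  have "loss V c DV f g \<sigma> uh l (t *\<^sub>R a + (1 - t) *\<^sub>R b) \<le>
      t * loss V c DV f g \<sigma> uh l a + (1 - t) * loss V c DV f g \<sigma> uh l b
        - 2 * m / 2 * t * (1 - t) * (norm (a - b))\<^sup>2"
    if a: "a \<in> \<Theta>" and b: "b \<in> \<Theta>" and t: "t \<in> {0..1}" for a b t
  proof -
    have ab: "t *\<^sub>R a + (1 - t) *\<^sub>R b \<in> \<Theta>"
      using t a b \<Theta>_convex by (auto intro: convexD)
    have "(\<integral>x. P (t *\<^sub>R a + (1 - t) *\<^sub>R b) x \<partial>?M) \<le>
        (\<integral>x. t * P a x + (1 - t) * P b x - t * (1 - t) * (norm (w (a - b) x))\<^sup>2 \<partial>?M)"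
      using t by (intro integral_mono int_P P_comb Bochner_Integration.integrable_diff
          Bochner_Integration.integrable_add integrable_mult_right int_w) auto
    also have "\<dots> = t * (\<integral>x. P a x \<partial>?M) + (1 - t) * (\<integral>x. P b x \<partial>?M)
        - t * (1 - t) * (\<integral>x. (norm (w (a - b) x))\<^sup>2 \<partial>?M)"
      by (simp add: int_P int_w)
    \<comment> \<open>The lower bound is used at the parameter difference \<open>a - b\<close>; its
      sign survives because \<open>t * (1 - t)\<close> is nonnegative.\<close>
    also have "\<dots> \<le> t * (\<integral>x. P a x \<partial>?M) + (1 - t) * (\<integral>x. P b x \<partial>?M)
        - t * (1 - t) * (m * (norm (a - b))\<^sup>2)"
      using t by (intro diff_left_mono mult_left_mono m(2)) auto
    finally show ?thesis
      unfolding loss_eq[OF a] loss_eq[OF b] loss_eq[OF ab] by (simp add: mult_ac)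
  qed
  then show "strongly_convex_on \<Theta> (loss V c DV f g \<sigma> uh l)"
    unfolding strongly_convex_on_def using \<Theta>_convex m(1)
    by (intro conjI exI[of _ "2 * m"] ballI) simp_all
qed

end
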